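(* Let $N=M\ge 2$ be an integer, let $0<r\le 1/N$, let $\{f_1,\dots,f_N\}$ be an IFS on $[0,1]$ as in the context, let $\mathbf p=(1/N,\dots,1/N)$, and let $F=F(\omega)$ be the random set defined in the context. Put $s=-\log N/\log r$. Then $\mathcal H^s(F(\omega))=0$ almost surely with respect to $\mu_{\mathbf p}$; that is, there is a set of $\omega$'s of full $\mu_{\mathbf p}$-measure for which $\mathcal H^s(F(\omega))=0$.
   Context: IFS: $f_i:[0,1]\to[0,1]$, $f_i(x)=rx+b_i$ for $i=1,\dots,N$, with constants $b_i$ such that the open intervals $f_i((0,1))$ are pairwise disjoint and $f_i([0,1])$ lies to the left of $f_j([0,1])$ when $i<j$. Probability space: $\Omega=\{1,\dots,N\}^{\mathbb N}$ ($\mathbb N=\{1,2,\dots\}$) with its Borel $\sigma$-algebra and the product measure $\mu_{\mathbf p}$ under which the coordinates $\omega_1,\omega_2,\dots$ are i.i.d. with $\mu_{\mathbf p}(\omega_k=i)=p_i$ (here $p_i=1/N$). Tree: let $\mathcal I_n=\{1,\dots,M\}^n$, $\mathcal I_0=\{\epsilon\}$ with $\epsilon$ the empty word, $\mathcal I^*=\bigcup_{n\ge0}\mathcal I_n$, and $\mathcal I=\{1,\dots,M\}^{\mathbb N}$. Order $\mathcal I^*$ by: $\mathbf i<_*\mathbf j$ if $\mathbf i$ is shorter than $\mathbf j$, or if they have equal length and $\mathbf i$ precedes $\mathbf j$ lexicographically. Put $\kappa(\mathbf i)=\#\{\mathbf j\in\mathcal I^*:\mathbf j<_*\mathbf i\}$,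 so that $\kappa$ maps the nonempty words bijectively onto $\mathbb N$. For nonempty $\mathbf i\in\mathcal I^*$ let $X_{\mathbf i}(\omega)=\omega_{\kappa(\mathbf i)}$ (the random label of the edge of the $M$-ary tree leading to the node $\mathbf i$). Random set: writing $\mathbf i|_k=(i_1,\dots,i_k)$, $$F(\omega)=\Big\{x:\ \{x\}=\bigcap_{n\ge1} f_{X_{\mathbf i|_1}(\omega)}\circ f_{X_{\mathbf i|_2}(\omega)}\circ\dots\circ f_{X_{\mathbf i|_n}(\omega)}([0,1])\ \text{ for some }\mathbf i\in\mathcal I\Big\}.$$ $\mathcal H^s$ is $s$-dimensional Hausdorff measure. *)

theory Defs
  imports "HOL-Probability.Probability"
begin

text \<open>The usual convention for the exponent 0 is that a nonempty set has weight 1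
  (whereas \<open>0 powr 0 = 0\<close>); the empty set always has weight 0.\<close>

definition diam_weight :: "real \<Rightarrow> 'a::metric_space set \<Rightarrow> ennreal" where
  "diam_weight s U =
     (if U = {} then 0 else if s = 0 then 1 else ennreal (diameter U powr s))"

definition hausdorff_premeasure :: "real \<Rightarrow> real \<Rightarrow> 'a::metric_space set \<Rightarrow> ennreal" where
  "hausdorff_premeasure s \<delta> A =
     (INF U \<in> {U :: nat \<Rightarrow> 'a set.
                A \<subseteq> (\<Union>n. U n) \<and> (\<forall>n. bounded (U n) \<and> diameter (U n) \<le> \<delta>)}.
        (\<Sum>n. diam_weight s (U n)))"

definition hausdorff_measure :: "real \<Rightarrow> 'a::metric_space set \<Rightarrow> ennreal" where
  "hausdorff_measure s A = (SUP \<delta> \<in> {0<..}. hausdorff_premeasure s \<delta> A)"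

text \<open>Neighbouring images \<open>f i ` {0..1}\<close> and \<open>f j ` {0..1}\<close> may share an endpoint.
  The values of \<open>f i\<close> outside \<open>{0..1}\<close> are irrelevant.\<close>

definition is_ifs :: "nat \<Rightarrow> real \<Rightarrow> (nat \<Rightarrow> real) \<Rightarrow> (nat \<Rightarrow> real \<Rightarrow> real) \<Rightarrow> bool" where
  "is_ifs N r b f \<longleftrightarrow>
     (\<forall>i\<in>{1..N}. \<forall>x\<in>{0..1}. f i x = r * x + b i) \<and>
     (\<forall>i\<in>{1..N}. f i ` {0..1} \<subseteq> {0..1}) \<and>
     (\<forall>i\<in>{1..N}. \<forall>j\<in>{1..N}. i \<noteq> j \<longrightarrow> f i ` {0<..<1} \<inter> f j ` {0<..<1} = {}) \<and>
     (\<forall>i\<in>{1..N}. \<forall>j\<in>{1..N}. i < j \<longrightarrow>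
        (\<forall>x \<in> f i ` {0..1}. \<forall>y \<in> f j ` {0..1}. x \<le> y))"

text \<open>Sample points are the functions \<open>\<omega> \<in> {1..} \<rightarrow>\<^sub>E {1..N}\<close>. The product sigma-algebra is
  the Borel sigma-algebra of this space, since the alphabet is finite and discrete.\<close>

definition label_measure :: "nat \<Rightarrow> (nat \<Rightarrow> real) \<Rightarrow> (nat \<Rightarrow> nat) measure" where
  "label_measure N p = PiM {1..} (\<lambda>_. point_measure {1..N} (\<lambda>i. ennreal (p i)))"

definition words :: "nat \<Rightarrow> nat list set" where
  "words M = lists {1..M}"

definition kappa :: "nat \<Rightarrow> nat list \<Rightarrow> nat" where
  "kappa M w = card {v \<in> words M. (v, w) \<in> lenlex less_than}"

definition edge_label :: "nat \<Rightarrow> nat list \<Rightarrow> (nat \<Rightarrow> nat) \<Rightarrow> nat" where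
  "edge_label M w \<omega> = \<omega> (kappa M w)"

definition infinite_words :: "nat \<Rightarrow> (nat \<Rightarrow> nat) set" where
  "infinite_words M = {1..} \<rightarrow>\<^sub>E {1..M}"

definition prefix_word :: "(nat \<Rightarrow> nat) \<Rightarrow> nat \<Rightarrow> nat list" where
  "prefix_word i k = map i [1..<Suc k]"

text \<open>The composition of \<open>f (edge_label M (prefix_word i k) \<omega>)\<close> for \<open>k = 1, \<dots>, n\<close>, in which
  the map for \<open>k = n\<close> is applied first.\<close>

definition path_map ::
  "(nat \<Rightarrow> real \<Rightarrow> real) \<Rightarrow> nat \<Rightarrow> (nat \<Rightarrow> nat) \<Rightarrow> (nat \<Rightarrow> nat) \<Rightarrow> nat \<Rightarrow> real \<Rightarrow> real" where
  "path_map f M \<omega> i n =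
     foldr (\<lambda>k g. f (edge_label M (prefix_word i k) \<omega>) \<circ> g) [1..<Suc n] id"

definition random_set :: "(nat \<Rightarrow> real \<Rightarrow> real) \<Rightarrow> nat \<Rightarrow> (nat \<Rightarrow> nat) \<Rightarrow> real set" where
  "random_set f M \<omega> =
     {x. \<exists>i \<in> infinite_words M. {x} = (\<Inter>n\<in>{1..}. path_map f M \<omega> i n ` {0..1})}"

end

theory Submission
  imports Defs
begin

text \<open>
  The set \<open>F(\<omega>)\<close> is covered, for each \<open>n\<close>, by the level-\<open>n\<close> cylinders (intervals of length
  \<open>r ^ n\<close>) of those label words of length \<open>n\<close> that can be read along some path from the root.
  Since \<open>r powr s = 1 / N\<close>, such a cover has \<open>s\<close>-weight \<open>N\<^sup>-\<^sup>n\<close> times the number of these words,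
  and there are \<open>N ^ n\<close> candidate words. Hence the expected weight is the probability \<open>q\<^sub>n\<close> that
  one given word of length \<open>n\<close> can be read.

  Fix a word. The nodes along which its prefixes can be read form a Galton--Watson process: each
  of the \<open>M\<close> children of such a node carries the required next label with probability \<open>1 / N\<close>,
  independently. For \<open>M = N \<ge> 2\<close> the mean offspring is 1 and the offspring number is not constant,
  so the process dies out, that is, \<open>q\<^sub>n \<longlonglongrightarrow> 0\<close>. Concretely \<open>q\<^sub>n\<close> is computed by decomposing at the root
  (\<open>prob_spells\<close>), which gives \<open>q\<^sub>n\<^sub>+\<^sub>1 = 1 - (1 - q\<^sub>n / N) ^ M\<close>; for \<open>M = N\<close> Bernoulli's inequality
  makes this sequence decrease and its strict form excludes a positive limit
  (\<open>survival_critical_tendsto_0\<close>).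

  So the expected weights of the covers tend to 0, and therefore almost surely the infimum of the
  weights over all levels \<open>n \<ge> m\<close> is 0 for every \<open>m\<close> (\<open>AE_tail_Inf_eq_0\<close>), which bounds every
  premeasure, and with them the Hausdorff measure, by 0.
\<close>

section \<open>Numbering of the words\<close>

lemma finite_lenlex_predecessors: "finite {v \<in> words M. (v, w) \<in> lenlex less_than}"
proof (rule finite_subset)
  show "{v \<in> words M. (v, w) \<in> lenlex less_than}
      \<subseteq> {v. set v \<subseteq> {1..M} \<and> length v \<le> length w}"
    by (auto simp: words_def lists_eq_set dest: lenlex_length)
qed (simp add: finite_lists_length_le)

lemma kappa_strict_mono:
  assumes "v \<in> words M" and "(v, w) \<in> lenlex less_than"
  shows "kappa M v < kappa M w"
  unfolding kappa_def
proof (rule psubset_card_mono[OF finite_lenlex_predecessors])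
  have "v \<notin> {u \<in> words M. (u, v) \<in> lenlex less_than}"
    by (simp add: lenlex_irreflexive)
  moreover have "(u, w) \<in> lenlex less_than" if "(u, v) \<in> lenlex less_than" for u
    using that assms(2) by (rule lenlex_trans) simp
  ultimately show "{u \<in> words M. (u, v) \<in> lenlex less_than}
      \<subset> {u \<in> words M. (u, w) \<in> lenlex less_than}"
    using assms by blast
qed

text \<open>Injectivity is what makes the labels of different edges independent.\<close>

lemma inj_on_kappa: "inj_on (kappa M) (words M)"
proof (rule inj_onI)
  fix v w assume vw: "v \<in> words M" "w \<in> words M" "kappa M v = kappa M w"
  have "total (lenlex less_than)"
    by (rule total_lenlex) simp
  then show "v = w"
    using vw kappa_strict_mono[of v M w] kappa_strict_mono[of w M v]
    by (auto simp: total_on_def)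
qed

lemma kappa_pos:
  assumes "w \<noteq> []"
  shows "kappa M w \<ge> 1"
proof -
  have "kappa M [] < kappa M w"
    using assms by (intro kappa_strict_mono) (auto simp: words_def)
  then show ?thesis by simp
qed


section \<open>Independence of events on disjoint sets of coordinates\<close>

text \<open>The coordinates of a product measure are independent, hence so are their restrictions to
  disjoint index sets. That \<open>P j\<close> is determined by the coordinates in \<open>K j\<close> is expressed through
  \<open>restrict\<close>, so that the same predicate can be used on \<open>PiM (K j) M\<close> and on \<open>PiM I M\<close>.\<close>

lemma measure_PiM_Ball_disjoint_coordinates:
  assumes ps: "\<And>i. i \<in> I \<Longrightarrow> prob_space (M i)"
    and L: "finite L" and K: "\<And>j. j \<in> L \<Longrightarrow> K j \<subseteq> I" and disj: "disjoint_family_on K L"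
    and meas: "\<And>j. j \<in> L \<Longrightarrow> {x \<in> space (PiM (K j) M). P j x} \<in> sets (PiM (K j) M)"
    and loc: "\<And>j x. j \<in> L \<Longrightarrow> P j (restrict x (K j)) = P j x"
  shows "measure (PiM I M) {x \<in> space (PiM I M). \<forall>j\<in>L. P j x} =
         (\<Prod>j\<in>L. measure (PiM I M) {x \<in> space (PiM I M). P j x})"
proof -
  interpret P: prob_space "PiM I M"
    using ps by (rule prob_space_PiM)
  show ?thesis
  proof (cases "L = {}")
    case True
    then show ?thesis by (simp add: P.prob_space)
  next
    case False
    show ?thesis
    proof (cases "I = {}")
      case True
      \<comment> \<open>The space is a single point, where every probability is 0 or 1.\<close>
      have "space (PiM I M) = {\<lambda>x. undefined}"
        by (simp add: True space_PiM)
      then have "{x \<in> space (PiM I M). Q x} = (if Q (\<lambda>x. undefined) then space (PiM I M) else {})"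
        for Q by auto
      then show ?thesis
        using L by (auto simp: P.prob_space)
    next
      case nonempty: False
      have "distr (PiM I M) (PiM I M) (\<lambda>x. restrict x I) = distr (PiM I M) (PiM I M) (\<lambda>x. x)"
        by (rule distr_cong) (auto simp: space_PiM PiE_restrict)
      also have "\<dots> = PiM I (\<lambda>i. distr (PiM I M) (M i) (\<lambda>x. x i))"
        using ps by (auto intro!: PiM_cong simp: distr_id2 distr_PiM_component)
      finally have "P.indep_vars M (\<lambda>i x. x i) I"
        using nonempty by (subst P.indep_vars_iff_distr_eq_PiM') (auto simp: restrict_def)
      then have "P.indep_vars (\<lambda>j. PiM (K j) M) (\<lambda>j x. restrict x (K j)) L"
        using P.indep_vars_restrict[OF _ K disj] by simp
      from P.indep_eventsI_indep_vars[OF this meas]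
      have "P.indep_events (\<lambda>j. {x \<in> space (PiM I M). P j (restrict x (K j))}) L" .
      then have "P.prob (\<Inter>j\<in>L. {x \<in> space (PiM I M). P j (restrict x (K j))}) =
          (\<Prod>j\<in>L. P.prob {x \<in> space (PiM I M). P j (restrict x (K j))})"
        unfolding P.indep_events_def using L False by blast
      moreover have "(\<Inter>j\<in>L. {x \<in> space (PiM I M). P j (restrict x (K j))}) =
          {x \<in> space (PiM I M). \<forall>j\<in>L. P j x}"
        using False loc by auto
      moreover have "{x \<in> space (PiM I M). P j (restrict x (K j))} = {x \<in> space (PiM I M). P j x}"
        if "j \<in> L" for j
        using loc[OF that] by simp
      ultimately show ?thesis by simp
    qed
  qed
qed


section \<open>Label words spelled by paths of the tree\<close>

text \<open>The word \<open>w\<close> can be read along some path that starts at the node \<open>u\<close> and goes down.\<close>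

fun spells :: "nat \<Rightarrow> nat list \<Rightarrow> nat list \<Rightarrow> (nat \<Rightarrow> nat) \<Rightarrow> bool" where
  "spells M u [] \<omega> \<longleftrightarrow> True"
| "spells M u (a # w) \<omega> \<longleftrightarrow> (\<exists>i\<in>{1..M}. edge_label M (u @ [i]) \<omega> = a \<and> spells M (u @ [i]) w \<omega>)"

text \<open>The coordinates of \<open>\<omega>\<close> that label the edges of the subtree rooted at \<open>u\<close>; the edge leading
  to \<open>u\<close> itself is excluded.\<close>

definition edges_below :: "nat \<Rightarrow> nat list \<Rightarrow> nat set" where
  "edges_below M u = kappa M ` {u @ v |v. v \<in> words M \<and> v \<noteq> []}"

abbreviation uniform_label :: "nat \<Rightarrow> nat measure" where
  "uniform_label N \<equiv> point_measure {1..N} (\<lambda>_. ennreal (1 / real N))"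

abbreviation uniform_labels :: "nat \<Rightarrow> (nat \<Rightarrow> nat) measure" where
  "uniform_labels N \<equiv> label_measure N (\<lambda>_. 1 / real N)"

lemma edges_below_step:
  assumes "i \<in> {1..M}"
  shows "insert (kappa M (u @ [i])) (edges_below M (u @ [i])) \<subseteq> edges_below M u"
proof -
  have "i # v \<in> words M" if "v \<in> words M" for v
    using assms that by (simp add: words_def)
  moreover have "[i] \<in> words M"
    using assms by (simp add: words_def)
  ultimately show ?thesis
    unfolding edges_below_def by fastforce
qed

lemma edges_below_positive: "edges_below M u \<subseteq> {1..}"
  using kappa_pos by (auto simp: edges_below_def)

lemma disjoint_sibling_subtrees:
  assumes "u \<in> words M"
  shows "disjoint_family_on (\<lambda>i. insert (kappa M (u @ [i])) (edges_below M (u @ [i]))) {1..M}"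
proof -
  have *: "insert (kappa M (u @ [i])) (edges_below M (u @ [i])) =
      kappa M ` {u @ i # v |v. v \<in> words M}" for i
    by (auto simp: edges_below_def words_def image_iff)
  show ?thesis
    unfolding disjoint_family_on_def *
    using assms
    by (auto simp: words_def dest!: inj_onD[OF inj_on_kappa[of M]])
qed

lemma kappa_notin_edges_below:
  assumes "u \<in> words M"
  shows "kappa M u \<notin> edges_below M u"
proof
  assume "kappa M u \<in> edges_below M u"
  then obtain v where v: "kappa M u = kappa M (u @ v)" "v \<in> words M" "v \<noteq> []"
    by (auto simp: edges_below_def)
  moreover have "u @ v \<in> words M"
    using assms v by (simp add: words_def)
  ultimately have "u = u @ v"
    using assms inj_on_kappa by (meson inj_onD)
  with v show False by simp
qed

lemma spells_cong:
  assumes "\<And>k. k \<in> edges_below M u \<Longrightarrow> \<omega> k = \<omega>' k"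
  shows "spells M u w \<omega> = spells M u w \<omega>'"
  using assms
proof (induction w arbitrary: u)
  case (Cons a w)
  have "edge_label M (u @ [i]) \<omega> = edge_label M (u @ [i]) \<omega>' \<and>
      spells M (u @ [i]) w \<omega> = spells M (u @ [i]) w \<omega>'" if "i \<in> {1..M}" for i
    using Cons.IH[of "u @ [i]"] Cons.prems edges_below_step[OF that, of u]
    by (auto simp: edge_label_def)
  then show ?case by auto
qed simp

lemma pred_coordinate_eq:
  assumes "k \<in> K"
  shows "Measurable.pred (PiM K (\<lambda>_. uniform_label N)) (\<lambda>\<omega>. \<omega> k = a)"
proof -
  have "(\<lambda>x. x = a) \<in> measurable (uniform_label N) (count_space UNIV)"
    by simp
  with measurable_component_singleton[OF assms] show ?thesis
    by (rule measurable_compose)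
qed

lemma pred_spells:
  assumes "edges_below M u \<subseteq> K"
  shows "Measurable.pred (PiM K (\<lambda>_. uniform_label N)) (spells M u w)"
  using assms
proof (induction w arbitrary: u)
  case (Cons a w)
  have "Measurable.pred (PiM K (\<lambda>_. uniform_label N))
      (\<lambda>\<omega>. edge_label M (u @ [i]) \<omega> = a \<and> spells M (u @ [i]) w \<omega>)" if "i \<in> {1..M}" for i
    using edges_below_step[OF that, of u] Cons.prems
    unfolding edge_label_def
    by (intro pred_intros_logic pred_coordinate_eq Cons.IH) auto
  then show ?case
    unfolding spells.simps by (intro pred_intros_finite) auto
next
  case (Nil u)
  have "spells M u [] = (\<lambda>_. True)"
    by auto
  then show ?case by simp
qed

lemma prob_space_uniform_label:
  assumes "N > 0"
  shows "prob_space (uniform_label N)"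
proof (rule prob_space_point_measure)
  show "(\<Sum>i\<in>{1..N}. ennreal (1 / real N)) = 1"
    using assms by (simp add: ennreal_of_nat_eq_real_of_nat flip: ennreal_mult)
qed auto

lemma prob_space_uniform_labels:
  assumes "N > 0"
  shows "prob_space (uniform_labels N)"
  unfolding label_measure_def using prob_space_uniform_label[OF assms] by (rule prob_space_PiM)

lemma prob_coordinate_eq:
  assumes "a \<in> {1..N}" and "k \<ge> 1"
  shows "measure (uniform_labels N) {\<omega> \<in> space (uniform_labels N). \<omega> k = a} = 1 / real N"
proof -
  have N: "N > 0"
    using assms by auto
  interpret product_prob_space "\<lambda>_::nat. uniform_label N" "{1..}"
    using prob_space_uniform_label[OF N]
    by (intro product_prob_spaceI)
  have "emeasure (uniform_labels N) {\<omega> \<in> space (uniform_labels N). \<omega> k \<in> {a}} =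
      emeasure (uniform_label N) {a}"
    unfolding label_measure_def using assms
    by (intro emeasure_PiM_Collect_single) (auto simp: sets_point_measure)
  also have "\<dots> = ennreal (1 / real N)"
    using assms by (subst emeasure_point_measure_finite) auto
  finally show ?thesis
    by (simp add: measure_def)
qed

text \<open>The probability that a Galton--Watson process with offspring distribution Binomial(\<open>M\<close>,
  \<open>1 / N\<close>) is alive in generation \<open>n\<close>.\<close>

fun survival :: "nat \<Rightarrow> nat \<Rightarrow> nat \<Rightarrow> real" where
  "survival M N 0 = 1"
| "survival M N (Suc n) = 1 - (1 - survival M N n / real N) ^ M"

text \<open>A word \<open>a # w\<close> fails to be spelled from \<open>u\<close> iff every child \<open>i\<close> of \<open>u\<close> has a wrong label or
  does not spell \<open>w\<close>. For different \<open>i\<close> these events concern disjoint subtrees, and within one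
  child the label of its edge is independent of the subtree below it. The probability depends
  neither on \<open>u\<close> nor on the letters, only on the length of the word.\<close>

lemma prob_spells:
  assumes "u \<in> words M" and "set w \<subseteq> {1..N}" and "N > 0"
  shows "measure (uniform_labels N) {\<omega> \<in> space (uniform_labels N). spells M u w \<omega>} =
    survival M N (length w)"
  using assms(1,2)
proof (induction w arbitrary: u)
  case Nil
  then show ?case
    using prob_space.prob_space[OF prob_space_uniform_labels[OF \<open>N > 0\<close>]] by simp
next
  case (Cons a w)
  let ?\<Omega> = "uniform_labels N"
  let ?K = "\<lambda>i. insert (kappa M (u @ [i])) (edges_below M (u @ [i]))"
  let ?E = "\<lambda>i \<omega>. \<omega> (kappa M (u @ [i])) = a \<and> spells M (u @ [i]) w \<omega>"
  interpret P: prob_space ?\<Omega>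
    using \<open>N > 0\<close> by (rule prob_space_uniform_labels)
  have ui: "u @ [i] \<in> words M" if "i \<in> {1..M}" for i
    using that Cons.prems by (simp add: words_def)
  have K: "?K i \<subseteq> {1..}" if "i \<in> {1..M}" for i
    using edges_below_step[OF that, of u] edges_below_positive[of M u] by (rule subset_trans)
  have pred_E: "Measurable.pred (PiM J (\<lambda>_. uniform_label N)) (?E i)" if "?K i \<subseteq> J" for i J
    using that by (intro pred_intros_logic pred_coordinate_eq pred_spells) auto
  have one: "P.prob {\<omega> \<in> space ?\<Omega>. ?E i \<omega>} = survival M N (length w) / real N"
    if i: "i \<in> {1..M}" for i
  proof -
    \<comment> \<open>The edge to child \<open>i\<close> and the subtree below it, as a family indexed by \<open>bool\<close>.\<close>
    let ?J = "\<lambda>e. if e then {kappa M (u @ [i])} else edges_below M (u @ [i])"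
    let ?Q = "\<lambda>e \<omega>. if e then \<omega> (kappa M (u @ [i])) = a else spells M (u @ [i]) w \<omega>"
    have "P.prob {\<omega> \<in> space ?\<Omega>. \<forall>e\<in>UNIV. ?Q e \<omega>} =
        (\<Prod>e\<in>UNIV. P.prob {\<omega> \<in> space ?\<Omega>. ?Q e \<omega>})"
      unfolding label_measure_def
    proof (rule measure_PiM_Ball_disjoint_coordinates[where K = ?J])
      show "?J e \<subseteq> {1..}" for e
        using K[OF i] by auto
      show "disjoint_family_on ?J UNIV"
        using kappa_notin_edges_below[OF ui[OF i]] by (auto simp: disjoint_family_on_def)
      show "{\<omega> \<in> space (PiM (?J e) (\<lambda>_. uniform_label N)). ?Q e \<omega>}
          \<in> sets (PiM (?J e) (\<lambda>_. uniform_label N))" for e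
        using pred_coordinate_eq pred_spells by (cases e) (auto simp: pred_def)
      show "?Q e (restrict \<omega> (?J e)) = ?Q e \<omega>" for e \<omega>
        by (auto intro!: spells_cong)
    qed (use \<open>N > 0\<close> prob_space_uniform_label in auto)
    moreover have "P.prob {\<omega> \<in> space ?\<Omega>. \<omega> (kappa M (u @ [i])) = a} = 1 / real N"
      using Cons.prems kappa_pos by (intro prob_coordinate_eq) auto
    moreover have "P.prob {\<omega> \<in> space ?\<Omega>. spells M (u @ [i]) w \<omega>} = survival M N (length w)"
      using Cons.prems ui[OF i] by (intro Cons.IH) auto
    moreover have "(\<forall>e\<in>UNIV. ?Q e \<omega>) \<longleftrightarrow> ?E i \<omega>" for \<omega>
      by (simp only: ball_UNIV all_bool_eq if_True if_False)
    ultimately show ?thesis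
      by (simp add: UNIV_bool)
  qed
  have E_sets: "{\<omega> \<in> space ?\<Omega>. ?E i \<omega>} \<in> P.events" if "i \<in> {1..M}" for i
    using pred_E[OF K[OF that]] by (simp add: label_measure_def pred_def)
  have "P.prob {\<omega> \<in> space ?\<Omega>. \<forall>i\<in>{1..M}. \<not> ?E i \<omega>} =
      (\<Prod>i\<in>{1..M}. P.prob {\<omega> \<in> space ?\<Omega>. \<not> ?E i \<omega>})"
    unfolding label_measure_def
  proof (rule measure_PiM_Ball_disjoint_coordinates[where K = ?K])
    show "disjoint_family_on ?K {1..M}"
      using Cons.prems by (intro disjoint_sibling_subtrees)
    show "{\<omega> \<in> space (PiM (?K i) (\<lambda>_. uniform_label N)). \<not> ?E i \<omega>}
        \<in> sets (PiM (?K i) (\<lambda>_. uniform_label N))" for i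
      using pred_E[of i "?K i"] by (intro predE pred_intros_logic(2)) simp
    show "(\<not> ?E i (restrict \<omega> (?K i))) = (\<not> ?E i \<omega>)" for i \<omega>
    proof -
      have "spells M (u @ [i]) w (restrict \<omega> (?K i)) = spells M (u @ [i]) w \<omega>"
        by (rule spells_cong) auto
      then show ?thesis by simp
    qed
  qed (use K \<open>N > 0\<close> prob_space_uniform_label in auto)
  also have "\<dots> = (\<Prod>i\<in>{1..M}. 1 - survival M N (length w) / real N)"
    using one P.prob_neg[OF E_sets] by (intro prod.cong) auto
  finally have none: "P.prob {\<omega> \<in> space ?\<Omega>. \<forall>i\<in>{1..M}. \<not> ?E i \<omega>} =
      (1 - survival M N (length w) / real N) ^ M"
    by simp
  have sp: "spells M u (a # w) \<omega> \<longleftrightarrow> \<not> (\<forall>i\<in>{1..M}. \<not> ?E i \<omega>)" for \<omega>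
    by (simp add: edge_label_def)
  have "{\<omega> \<in> space ?\<Omega>. \<forall>i\<in>{1..M}. \<not> ?E i \<omega>} \<in> P.events"
    using E_sets by (intro sets.sets_Collect_finite_All sets.sets_Collect_neg) auto
  from P.prob_neg[OF this] show ?case
    unfolding sp none by simp
qed


section \<open>Extinction of the critical branching process\<close>

lemma survival_bounds:
  assumes "N > 0"
  shows "0 \<le> survival M N n \<and> survival M N n \<le> 1"
proof (induction n)
  case (Suc n)
  have "0 \<le> 1 - survival M N n / real N" "1 - survival M N n / real N \<le> 1"
    using Suc assms by (auto simp: divide_le_eq_1)
  then show ?case
    by (simp add: power_le_one)
qed simp

lemma strict_Bernoulli_inequality:
  fixes x :: real
  assumes "0 < x" and "x \<le> 1" and "n \<ge> 2"
  shows "1 - real n * x < (1 - x) ^ n"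
proof -
  obtain k where k: "n = Suc k" "k > 0"
    using assms(3) by (cases n) auto
  have "0 < real k * x\<^sup>2"
    using assms k by simp
  then have "1 - real n * x < (1 - x) * (1 + real k * (- x))"
    by (simp add: k algebra_simps power2_eq_square)
  also have "\<dots> \<le> (1 - x) * (1 + (- x)) ^ k"
    using assms by (intro mult_left_mono Bernoulli_inequality) auto
  finally show ?thesis by (simp add: k)
qed

text \<open>The limit \<open>L\<close> satisfies \<open>1 - L = (1 - L / N) ^ N\<close>, which the strict Bernoulli inequality
  rules out for positive \<open>L\<close>. For \<open>N = 1\<close> the sequence is constantly 1.\<close>

lemma survival_critical_tendsto_0:
  assumes "N \<ge> 2"
  shows "survival N N \<longlonglongrightarrow> 0"
proof -
  have bounds: "0 \<le> survival N N n \<and> survival N N n \<le> 1" for n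
    using assms by (intro survival_bounds) simp
  have "survival N N (Suc n) \<le> survival N N n" for n
  proof -
    have "1 + real N * (- (survival N N n / real N)) \<le> (1 + (- (survival N N n / real N))) ^ N"
      using bounds[of n] assms by (intro Bernoulli_inequality) (auto simp: divide_le_eq_1)
    then show ?thesis
      using assms by simp
  qed
  then have "decseq (survival N N)"
    by (rule decseq_SucI)
  then obtain L where L: "survival N N \<longlonglongrightarrow> L"
    using bounds by (auto elim: decseq_convergent[where B = 0])
  have "(\<lambda>n. survival N N (Suc n)) \<longlonglongrightarrow> 1 - (1 - L / real N) ^ N"
    unfolding survival.simps using L assms by (intro tendsto_intros) auto
  then have fixpoint: "L = 1 - (1 - L / real N) ^ N"
    using L by (metis LIMSEQ_Suc LIMSEQ_unique)
  have "0 \<le> L" "L \<le> 1"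
    using L bounds by (auto intro: LIMSEQ_le_const LIMSEQ_le_const2)
  moreover have "\<not> 0 < L"
  proof
    assume "0 < L"
    then have "1 - real N * (L / real N) < (1 - L / real N) ^ N"
      using assms \<open>L \<le> 1\<close> by (intro strict_Bernoulli_inequality) (auto simp: divide_le_eq_1)
    then show False
      using fixpoint assms by simp
  qed
  ultimately show ?thesis
    using L by simp
qed


section \<open>Covers by cylinder sets\<close>

definition cylinder :: "(nat \<Rightarrow> real \<Rightarrow> real) \<Rightarrow> nat list \<Rightarrow> real set" where
  "cylinder f w = foldr (\<lambda>a g. f a \<circ> g) w id ` {0..1}"

definition spelled_words :: "nat \<Rightarrow> nat \<Rightarrow> nat \<Rightarrow> (nat \<Rightarrow> nat) \<Rightarrow> nat list set" where
  "spelled_words M N n \<omega> = {w. set w \<subseteq> {1..N} \<and> length w = n \<and> spells M [] w \<omega>}"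

lemma finite_spelled_words: "finite (spelled_words M N n \<omega>)"
  unfolding spelled_words_def
  by (rule finite_subset[OF _ finite_lists_length_eq[of "{1..N}" n]]) auto

text \<open>The premeasure takes covers that are sequences; a finite cover is padded with empty sets,
  which weigh nothing.\<close>

lemma hausdorff_premeasure_le_finite_cover:
  assumes "finite W" and cover: "A \<subseteq> (\<Union>w\<in>W. U w)"
    and U: "\<And>w. w \<in> W \<Longrightarrow> bounded (U w) \<and> diameter (U w) \<le> d"
    and "0 \<le> d" "d \<le> \<delta>" "0 < s"
  shows "hausdorff_premeasure s \<delta> A \<le> of_nat (card W) * ennreal (d powr s)"
proof -
  obtain h where h: "bij_betw h {0..<card W} W"
    using ex_bij_betw_nat_finite[OF \<open>finite W\<close>] by blast
  let ?V = "\<lambda>n. if n < card W then U (h n) else {}"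
  have hW: "h n \<in> W" if "n < card W" for n
    using bij_betwE[OF h] that by simp
  have "A \<subseteq> (\<Union>n. ?V n)"
  proof
    fix x assume "x \<in> A"
    then obtain w where "w \<in> W" "x \<in> U w"
      using cover by blast
    moreover have "w \<in> h ` {0..<card W}"
      using h \<open>w \<in> W\<close> by (simp add: bij_betw_imp_surj_on)
    ultimately obtain n where "n < card W" "x \<in> U (h n)"
      by auto
    then have "x \<in> ?V n" by simp
    then show "x \<in> (\<Union>n. ?V n)" by blast
  qed
  moreover have "bounded (?V n) \<and> diameter (?V n) \<le> \<delta>" for n
    using U[OF hW[of n]] assms(4,5) by auto
  ultimately have "hausdorff_premeasure s \<delta> A \<le> (\<Sum>n. diam_weight s (?V n))"
    unfolding hausdorff_premeasure_def by (intro INF_lower) blast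
  also have "\<dots> = (\<Sum>n<card W. diam_weight s (?V n))"
    by (intro suminf_finite) (auto simp: diam_weight_def)
  also have "\<dots> \<le> (\<Sum>n<card W. ennreal (d powr s))"
  proof (rule sum_mono)
    fix n assume "n \<in> {..<card W}"
    then show "diam_weight s (?V n) \<le> ennreal (d powr s)"
      using U[OF hW[of n]] \<open>0 < s\<close>
      by (auto simp: diam_weight_def intro!: ennreal_leI powr_mono2 diameter_ge_0)
  qed
  finally show ?thesis by simp
qed

lemma ifs_composition:
  assumes "is_ifs N r b f" and "0 < r" and "set w \<subseteq> {1..N}" and "x \<in> {0..1}"
  shows "foldr (\<lambda>a g. f a \<circ> g) w id x \<in> {0..1} \<and>
    (\<forall>y\<in>{0..1}. \<bar>foldr (\<lambda>a g. f a \<circ> g) w id x - foldr (\<lambda>a g. f a \<circ> g) w id y\<bar> =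
      r ^ length w * \<bar>x - y\<bar>)"
  using assms(3,4)
proof (induction w arbitrary: x)
  case (Cons a w)
  let ?c = "\<lambda>w. foldr (\<lambda>a g. f a \<circ> g) w id"
  have a: "a \<in> {1..N}" and w: "set w \<subseteq> {1..N}"
    using Cons.prems by simp_all
  have affine: "f a z = r * z + b a" if "z \<in> {0..1}" for z
    using assms(1) a that unfolding is_ifs_def by simp
  have "\<forall>i\<in>{1..N}. f i ` {0..1} \<subseteq> {0..1}"
    using assms(1) unfolding is_ifs_def by (elim conjE)
  then have "f a ` {0..1} \<subseteq> {0..1}"
    using a by (rule bspec)
  then have maps: "f a z \<in> {0..1}" if "z \<in> {0..1}" for z
    using that by (rule subsetD[OF _ imageI])
  note unit = Cons.IH[OF w, THEN conjunct1] and dist = Cons.IH[OF w, THEN conjunct2, THEN bspec]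
  have step: "?c (a # w) z = f a (?c w z)" for z
    by simp
  show ?case
  proof (intro conjI ballI)
    show "?c (a # w) x \<in> {0..1}"
      unfolding step by (rule maps[OF unit[OF Cons.prems(2)]])
    fix y :: real assume y: "y \<in> {0..1}"
    have "\<bar>?c (a # w) x - ?c (a # w) y\<bar> = \<bar>r * (?c w x - ?c w y)\<bar>"
      unfolding step affine[OF unit[OF Cons.prems(2)]] affine[OF unit[OF y]]
      by (simp add: right_diff_distrib)
    also have "\<dots> = r * \<bar>?c w x - ?c w y\<bar>"
      using \<open>0 < r\<close> by (simp add: abs_mult)
    also have "\<dots> = r ^ length (a # w) * \<bar>x - y\<bar>"
      unfolding dist[OF Cons.prems(2) y] by simp
    finally show "\<bar>?c (a # w) x - ?c (a # w) y\<bar> = r ^ length (a # w) * \<bar>x - y\<bar>" .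
  qed
qed simp

lemma bounded_diameter_cylinder:
  assumes "is_ifs N r b f" and "0 < r" and "set w \<subseteq> {1..N}"
  shows "bounded (cylinder f w) \<and> diameter (cylinder f w) \<le> r ^ length w"
proof
  have "cylinder f w \<subseteq> {0..1}"
    using ifs_composition[OF assms] unfolding cylinder_def by blast
  then show "bounded (cylinder f w)"
    using bounded_closed_interval bounded_subset by blast
  show "diameter (cylinder f w) \<le> r ^ length w"
  proof (rule diameter_le)
    fix x y assume "x \<in> cylinder f w" "y \<in> cylinder f w"
    then obtain x' y' where "x' \<in> {0..1}" "y' \<in> {0..1}"
      "\<bar>x - y\<bar> = r ^ length w * \<bar>x' - y'\<bar>"
      unfolding cylinder_def using ifs_composition[OF assms, THEN conjunct2, THEN bspec] by blast
    moreover from this have "\<bar>x' - y'\<bar> \<le> 1" by auto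
    ultimately show "norm (x - y) \<le> r ^ length w"
      using \<open>0 < r\<close> by (simp add: mult_left_le)
  qed (auto simp: cylinder_def)
qed

lemma spells_along_path:
  assumes "i \<in> infinite_words M"
  shows "spells M (prefix_word i m)
    (map (\<lambda>k. edge_label M (prefix_word i k) \<omega>) [Suc m..<Suc (m + n)]) \<omega>"
proof (induction n arbitrary: m)
  case (Suc n)
  have "i (Suc m) \<in> {1..M}"
    using assms unfolding infinite_words_def by (rule PiE_mem) simp
  moreover have "prefix_word i m @ [i (Suc m)] = prefix_word i (Suc m)"
    by (simp add: prefix_word_def)
  moreover have "[Suc m..<Suc (m + Suc n)] = Suc m # [Suc (Suc m)..<Suc (Suc m + n)]"
    by (subst upt_conv_Cons) (simp_all del: upt_Suc)
  ultimately show ?case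
    using Suc.IH[of "Suc m"] by (auto simp del: upt_Suc intro!: bexI[of _ "i (Suc m)"])
qed simp

text \<open>For a point of the random set, the labels along the first \<open>n\<close> edges of its path form a
  spelled word, and \<open>path_map\<close> is the composition along that word.\<close>

lemma random_set_subset_cylinders:
  assumes \<omega>: "\<omega> \<in> space (label_measure N p)" and "n \<ge> 1"
  shows "random_set f M \<omega> \<subseteq> (\<Union>w\<in>spelled_words M N n \<omega>. cylinder f w)"
proof
  fix x assume "x \<in> random_set f M \<omega>"
  then obtain i where i: "i \<in> infinite_words M"
    and "{x} = (\<Inter>n\<in>{1..}. path_map f M \<omega> i n ` {0..1})"
    by (auto simp: random_set_def)
  then have x: "x \<in> path_map f M \<omega> i n ` {0..1}"
    using \<open>n \<ge> 1\<close> by blast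
  let ?w = "map (\<lambda>k. edge_label M (prefix_word i k) \<omega>) [1..<Suc n]"
  have "x \<in> cylinder f ?w"
    using x by (simp add: cylinder_def path_map_def foldr_map comp_def del: upt_Suc)
  moreover have "spells M [] ?w \<omega>"
    using spells_along_path[OF i, of 0 \<omega> n] by (simp add: prefix_word_def del: upt_Suc)
  moreover have "edge_label M (prefix_word i k) \<omega> \<in> {1..N}" if "k \<ge> 1" for k
  proof -
    have "kappa M (prefix_word i k) \<ge> 1"
      using that by (intro kappa_pos) (auto simp: prefix_word_def)
    then show ?thesis
      using \<omega> by (auto simp: label_measure_def space_PiM space_point_measure edge_label_def PiE_iff)
  qed
  ultimately have "x \<in> cylinder f ?w" "?w \<in> spelled_words M N n \<omega>"
    by (auto simp: spelled_words_def simp del: upt_Suc)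
  then show "x \<in> (\<Union>w\<in>spelled_words M N n \<omega>. cylinder f w)" by blast
qed


section \<open>The expected number of spelled words\<close>

text \<open>Linearity of expectation over the \<open>N ^ n\<close> words of length \<open>n\<close>, each of which is spelled with
  the same probability.\<close>

lemma measurable_card_spelled_words:
  "(\<lambda>\<omega>. of_nat (card (spelled_words M N n \<omega>)) :: ennreal) \<in> borel_measurable (uniform_labels N)"
  and nn_integral_card_spelled_words:
  "N > 0 \<Longrightarrow> (\<integral>\<^sup>+\<omega>. of_nat (card (spelled_words M N n \<omega>)) \<partial>uniform_labels N) =
    ennreal (real N ^ n * survival M N n)"
proof -
  let ?\<Omega> = "uniform_labels N"
  let ?W = "{w. set w \<subseteq> {1..N} \<and> length w = n}"
  let ?S = "\<lambda>w. {\<omega> \<in> space ?\<Omega>. spells M [] w \<omega>}"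
  have fin: "finite ?W"
    by (simp add: finite_lists_length_eq)
  have S: "?S w \<in> sets ?\<Omega>" for w
    using pred_spells[OF edges_below_positive] by (simp add: label_measure_def pred_def)
  have eq: "of_nat (card (spelled_words M N n \<omega>)) = (\<Sum>w\<in>?W. indicator (?S w) \<omega> :: ennreal)"
    if "\<omega> \<in> space ?\<Omega>" for \<omega>
  proof -
    have "spelled_words M N n \<omega> = {w \<in> ?W. \<omega> \<in> ?S w}"
      using that by (auto simp: spelled_words_def)
    then show ?thesis
      using fin by (simp add: indicator_def sum.If_cases Int_def)
  qed
  show "(\<lambda>\<omega>. of_nat (card (spelled_words M N n \<omega>)) :: ennreal) \<in> borel_measurable ?\<Omega>"
    using S by (subst measurable_cong[OF eq]) auto
  assume N: "N > 0"
  interpret P: prob_space ?\<Omega>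
    using N by (rule prob_space_uniform_labels)
  have "(\<integral>\<^sup>+\<omega>. of_nat (card (spelled_words M N n \<omega>)) \<partial>?\<Omega>) =
      (\<integral>\<^sup>+\<omega>. (\<Sum>w\<in>?W. indicator (?S w) \<omega>) \<partial>?\<Omega>)"
    by (rule nn_integral_cong) (rule eq)
  also have "\<dots> = (\<Sum>w\<in>?W. emeasure ?\<Omega> (?S w))"
    using S by (simp add: nn_integral_sum)
  also have "\<dots> = (\<Sum>w\<in>?W. ennreal (survival M N n))"
    using prob_spells[of "[]" M _ N] N
    by (intro sum.cong) (auto simp: P.emeasure_eq_measure words_def)
  also have "\<dots> = ennreal (real N ^ n * survival M N n)"
    using survival_bounds[OF N]
    by (simp add: card_lists_length_eq ennreal_mult ennreal_of_nat_eq_real_of_nat)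
  finally show "(\<integral>\<^sup>+\<omega>. of_nat (card (spelled_words M N n \<omega>)) \<partial>?\<Omega>) =
      ennreal (real N ^ n * survival M N n)" .
qed

text \<open>The tail infimum lies below every \<open>Y n\<close> with \<open>n \<ge> m\<close>, so its integral is at most the limit of
  theirs, which is 0. Taking all \<open>m\<close> at once leaves room to discard the covers that are too
  coarse for a given \<open>\<delta>\<close>.\<close>

lemma AE_tail_Inf_eq_0:
  fixes Y :: "nat \<Rightarrow> 'a \<Rightarrow> ennreal"
  assumes meas: "\<And>n. Y n \<in> borel_measurable \<Omega>"
    and lim: "(\<lambda>n. \<integral>\<^sup>+x. Y n x \<partial>\<Omega>) \<longlonglongrightarrow> 0"
  shows "AE x in \<Omega>. \<forall>m. (INF n\<in>{m..}. Y n x) = 0"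
  unfolding AE_all_countable
proof
  fix m
  have "(\<integral>\<^sup>+x. (INF n\<in>{m..}. Y n x) \<partial>\<Omega>) \<le> 0"
  proof (rule LIMSEQ_le_const[OF lim], intro exI allI impI)
    fix n assume "m \<le> n"
    then show "(\<integral>\<^sup>+x. (INF n\<in>{m..}. Y n x) \<partial>\<Omega>) \<le> (\<integral>\<^sup>+x. Y n x \<partial>\<Omega>)"
      by (intro nn_integral_mono INF_lower) simp
  qed
  moreover have "(\<lambda>x. INF n\<in>{m..}. Y n x) \<in> borel_measurable \<Omega>"
    using meas by measurable
  ultimately show "AE x in \<Omega>. (INF n\<in>{m..}. Y n x) = 0"
    by (simp add: nn_integral_0_iff_AE)
qed


section \<open>Almost sure vanishing of the Hausdorff measure\<close>

theorem proposition5p1: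
  fixes N M :: nat and r s :: real and b p :: "nat \<Rightarrow> real"
    and f :: "nat \<Rightarrow> real \<Rightarrow> real"
  assumes "N = M" and "M \<ge> 2"
    and "0 < r" and "r \<le> 1 / real N"
    and "is_ifs N r b f"
    and "p = (\<lambda>i. 1 / real N)"
    and "s = - ln (real N) / ln r"
  shows "AE \<omega> in label_measure N p. hausdorff_measure s (random_set f M \<omega>) = 0"
proof -
  have N: "N \<ge> 2"
    using assms(1,2) by simp
  have "1 / real N < 1"
    using N by simp
  then have r1: "r < 1"
    using \<open>r \<le> 1 / real N\<close> by linarith
  have s: "0 < s"
    using N \<open>0 < r\<close> r1 unfolding \<open>s = _\<close> by (simp add: divide_pos_neg)
  have "r powr s = exp (- ln (real N))"
    using \<open>0 < r\<close> r1 by (simp add: powr_def \<open>s = _\<close>)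
  then have rs: "r powr s = 1 / real N"
    using N by (simp add: exp_minus inverse_eq_divide)
  have weight: "(r ^ n) powr s = (1 / real N) ^ n" for n
    using \<open>0 < r\<close> by (induction n) (simp_all add: powr_mult rs)
  \<comment> \<open>The \<open>s\<close>-weight of the cover by cylinders of level \<open>n\<close>.\<close>
  define Y where "Y n \<omega> = of_nat (card (spelled_words N N n \<omega>)) * ennreal ((1 / real N) ^ n)" for n \<omega>
  have "(\<integral>\<^sup>+\<omega>. Y n \<omega> \<partial>uniform_labels N) = ennreal (survival N N n)" for n
  proof -
    have "(\<integral>\<^sup>+\<omega>. Y n \<omega> \<partial>uniform_labels N) =
        ennreal (real N ^ n * survival N N n) * ennreal ((1 / real N) ^ n)"
      unfolding Y_def using N
      by (subst nn_integral_multc)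
        (auto intro: measurable_card_spelled_words simp: nn_integral_card_spelled_words)
    also have "\<dots> = ennreal (real N ^ n * survival N N n * (1 / real N) ^ n)"
      using survival_bounds[of N N n] N by (subst ennreal_mult) auto
    finally show ?thesis
      using N by (simp add: power_divide)
  qed
  moreover have "(\<lambda>n. ennreal (survival N N n)) \<longlonglongrightarrow> 0"
    using tendsto_ennrealI[OF survival_critical_tendsto_0[OF N]] by simp
  ultimately have "AE \<omega> in uniform_labels N. \<forall>m. (INF n\<in>{m..}. Y n \<omega>) = 0"
    using measurable_card_spelled_words
    by (intro AE_tail_Inf_eq_0) (auto simp: Y_def)
  then have "AE \<omega> in uniform_labels N. hausdorff_measure s (random_set f M \<omega>) = 0"
  proof (rule AE_mp, intro AE_I2 impI)
    fix \<omega> assume \<omega>: "\<omega> \<in> space (uniform_labels N)" and inf: "\<forall>m. (INF n\<in>{m..}. Y n \<omega>) = 0"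
    have "hausdorff_premeasure s \<delta> (random_set f M \<omega>) = 0" if "0 < \<delta>" for \<delta>
    proof -
      obtain m where m: "r ^ m < \<delta>"
        using real_arch_pow_inv[OF \<open>0 < \<delta>\<close> r1] by blast
      \<comment> \<open>The tail starts at \<open>Suc m\<close> because the intersection that defines a point of the random
        set runs over the levels \<open>n \<ge> 1\<close>.\<close>
      have "hausdorff_premeasure s \<delta> (random_set f M \<omega>) \<le> Y n \<omega>" if "n \<in> {Suc m..}" for n
      proof -
        have "r ^ n \<le> r ^ m"
          using that \<open>0 < r\<close> r1 by (intro power_decreasing) auto
        then have "hausdorff_premeasure s \<delta> (random_set f M \<omega>) \<le>
            of_nat (card (spelled_words M N n \<omega>)) * ennreal ((r ^ n) powr s)"
          using m that \<open>0 < r\<close> s bounded_diameter_cylinder[OF \<open>is_ifs N r b f\<close> \<open>0 < r\<close>]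
          by (intro hausdorff_premeasure_le_finite_cover[where U = "cylinder f"]
              finite_spelled_words random_set_subset_cylinders[OF \<omega>])
            (auto simp: spelled_words_def)
        then show ?thesis
          by (simp add: Y_def weight \<open>N = M\<close>)
      qed
      then have "hausdorff_premeasure s \<delta> (random_set f M \<omega>) \<le> (INF n\<in>{Suc m..}. Y n \<omega>)"
        by (rule INF_greatest)
      then show ?thesis
        using inf by simp
    qed
    then show "hausdorff_measure s (random_set f M \<omega>) = 0"
      by (auto simp: hausdorff_measure_def bot_ennreal[symmetric])
  qed
  then show ?thesis
    unfolding assms(6) .
qed

end
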